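(* For every real $\varepsilon>0$ there is $q_0>0$ such that for every integer $q>q_0$ and every colouring of the edges of the complete graph $K_{2^q+1}$ with $q$ colours, there is a monochromatic odd cycle of length at most $\frac{2^{q}+1}{q^{1-\varepsilon}}$.
   Context: $K_N$ denotes the complete graph on $N$ vertices. A $q$-edge-colouring of $K_N$ is an arbitrary assignment of one of $q$ colours to each edge (not necessarily proper). A monochromatic odd cycle is a cycle of odd length (at least 3), as a subgraph of $K_N$, all of whose edges have the same colour; the length of a cycle is its number of edges. *)

theory Defs
  imports Complex_Main
begin

definition complete_graph_edges :: "nat \<Rightarrow> nat set set" where
  "complete_graph_edges N = {e. e \<subseteq> {..<N} \<and> card e = 2}"

text \<open>A colouring is a function on all sets of vertices; only its values on edges are
  constrained or used. It need not be proper, and it need not use every colour.\<close>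

definition edge_colouring :: "nat \<Rightarrow> nat \<Rightarrow> (nat set \<Rightarrow> nat) \<Rightarrow> bool" where
  "edge_colouring q N c \<longleftrightarrow> (\<forall>e \<in> complete_graph_edges N. c e < q)"

text \<open>A cycle is given by a list of its vertices in cyclic order, so the last vertex of the
  list is adjacent to the first one, which is not repeated.\<close>

definition cycle_edges :: "'a list \<Rightarrow> 'a set set" where
  "cycle_edges vs = {{vs ! i, vs ! (Suc i mod length vs)} | i. i < length vs}"

definition is_cycle :: "'a set set \<Rightarrow> 'a list \<Rightarrow> bool" where
  "is_cycle E vs \<longleftrightarrow> length vs \<ge> 3 \<and> distinct vs \<and> cycle_edges vs \<subseteq> E"

definition cycle_length :: "'a list \<Rightarrow> nat" where
  "cycle_length vs = card (cycle_edges vs)"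

definition monochromatic :: "('a set \<Rightarrow> nat) \<Rightarrow> 'a list \<Rightarrow> bool" where
  "monochromatic c vs \<longleftrightarrow> (\<exists>k. \<forall>e \<in> cycle_edges vs. c e = k)"

lemma cycle_length_eq_length:
  assumes "is_cycle E vs"
  shows "cycle_length vs = length vs"
proof -
  let ?n = "length vs"
  let ?s = "\<lambda>i. Suc i mod ?n"
  let ?f = "\<lambda>i. {vs ! i, vs ! ?s i}"
  have n: "?n \<ge> 3" and d: "distinct vs"
    using assms by (auto simp: is_cycle_def)
  have s_less: "?s i < ?n" for i
    using n by (intro mod_less_divisor) linarith
  have s_eq: "?s i = (if Suc i = ?n then 0 else Suc i)" if "i < ?n" for i
    using that by auto
  have "inj_on ?f {..<?n}"
  proof (rule inj_onI)
    fix i j assume ij: "i \<in> {..<?n}" "j \<in> {..<?n}" and eq: "?f i = ?f j"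
    from eq have "i = j \<or> (i = ?s j \<and> ?s i = j)"
      using ij s_less d by (auto simp: doubleton_eq_iff nth_eq_iff_index_eq)
    then show "i = j"
      using ij n s_eq[of i] s_eq[of j] by (auto split: if_splits)
  qed
  moreover have "cycle_edges vs = ?f ` {..<?n}"
    by (auto simp: cycle_edges_def)
  ultimately show ?thesis
    by (simp add: cycle_length_def card_image)
qed

end

theory Submission
  imports Defs "HOL-Real_Asymp.Real_Asymp"
begin

text \<open>Let \<open>N = 2 ^ q + 1\<close>. If every colour graph \<open>G\<^sub>i\<close> carried a matrix \<open>Z\<^sub>i\<close> with \<open>Z\<^sub>i - J\<close> a Gram
  matrix (\<open>J\<close> the all-ones matrix), zero on the edges and at most \<open>t\<close> on the diagonal, then the
  Hadamard product of the \<open>Z\<^sub>i\<close> would be diagonal and dominate \<open>J\<close>, so that \<open>N \<le> t ^ q\<close>. For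
  \<open>t = 2 + 1 / (q * 2 ^ q)\<close> this fails, so by semidefinite duality some colour graph carries a
  weighted adjacency matrix \<open>B\<close> with smallest eigenvalue at least \<open>-1\<close> and largest eigenvalue
  noticeably above \<open>1\<close>. Let \<open>T\<close> be the Chebyshev polynomial of degree \<open>3 ^ j\<close>, an iterate of
  \<open>4 x ^ 3 - 3 x\<close>. Then \<open>I + T(B)\<close> is positive semidefinite; if there is no odd cycle of
  length at most \<open>3 ^ j\<close>, then \<open>T(B)\<close> has zero diagonal, so the trace of \<open>I + T(B)\<close> is \<open>N\<close>.
  But \<open>T\<close> grows so fast beyond \<open>1\<close> that the top eigenvalue alone exceeds \<open>N\<close> once \<open>3 ^ j\<close> is of
  order \<open>q powr (3/2) * 2 powr (q/2)\<close>.\<close>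

subsection \<open>Dominated linear functionals\<close>

text \<open>Homogeneity is stated as an inequality; applying it with \<open>c\<close> and with
  \<open>1 / c\<close> gives equality.\<close>

definition sublinear :: "(('i \<Rightarrow> real) \<Rightarrow> real) \<Rightarrow> bool" where
  "sublinear p \<longleftrightarrow> (\<forall>u v. p (\<lambda>i. u i + v i) \<le> p u + p v) \<and>
    (\<forall>c>0. \<forall>u. p (\<lambda>i. c * u i) \<le> c * p u)"

lemma sublinear_add: "sublinear p \<Longrightarrow> p (\<lambda>i. u i + v i) \<le> p u + p v"
  by (simp add: sublinear_def)

lemma sublinear_scale: "sublinear p \<Longrightarrow> c > 0 \<Longrightarrow> p (\<lambda>i. c * u i) \<le> c * p u"
  by (simp add: sublinear_def)

lemma sublinear_zero:
  assumes "sublinear p" shows "p (\<lambda>i. 0) = 0"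
  using sublinear_scale[OF assms, of 2 "\<lambda>i. 0"] sublinear_scale[OF assms, of "1/2" "\<lambda>i. 0"]
  by simp

lemma sublinear_minus:
  assumes "sublinear p" shows "0 \<le> p u + p (\<lambda>i. - u i)"
  using sublinear_add[OF assms, of u "\<lambda>i. - u i"] sublinear_zero[OF assms] by simp

text \<open>One Hahn-Banach step: \<open>r u\<close> is the infimum over \<open>s \<ge> 0\<close> of
  \<open>p (u + s y) - s p y\<close>. As \<open>r y \<le> p y\<close>, the last conjunct forces
  \<open>r\<close> to be linear along \<open>y\<close> and to agree with \<open>p\<close>
  there.\<close>

lemma sublinear_linear_along:
  fixes y :: "'i \<Rightarrow> real"
  assumes p: "sublinear p"
  shows "\<exists>r. sublinear r \<and> (\<forall>u. r u \<le> p u) \<and> r (\<lambda>i. - y i) \<le> - p y"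
proof -
  define S where "S u = (\<lambda>s. p (\<lambda>i. u i + s * y i) - s * p y) ` {0..}" for u
  define r where "r u = Inf (S u)" for u
  \<comment> \<open>This bound keeps the infimum finite.\<close>
  have lower: "- p (\<lambda>i. - u i) \<le> z" if z: "z \<in> S u" for u z
  proof -
    obtain s where s: "s \<ge> 0" "z = p (\<lambda>i. u i + s * y i) - s * p y"
      using z by (auto simp: S_def)
    have "s * p y \<le> p (\<lambda>i. s * y i)"
    proof (cases "s = 0")
      case True then show ?thesis using sublinear_zero[OF p] by simp
    next
      case False
      then have "p (\<lambda>i. inverse s * (s * y i)) \<le> inverse s * p (\<lambda>i. s * y i)"
        using s by (intro sublinear_scale[OF p]) auto
      also have "(\<lambda>i. inverse s * (s * y i)) = y" using False by (auto simp: field_simps)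
      finally show ?thesis using False s(1) by (simp add: field_simps)
    qed
    also have "\<dots> \<le> p (\<lambda>i. u i + s * y i) + p (\<lambda>i. - u i)"
      using sublinear_add[OF p, of "\<lambda>i. u i + s * y i" "\<lambda>i. - u i"] by simp
    finally show ?thesis using s by simp
  qed
  have ne: "S u \<noteq> {}" for u by (auto simp: S_def)
  have bdd: "bdd_below (S u)" for u unfolding bdd_below_def using lower by blast
  have r_le: "r u \<le> p (\<lambda>i. u i + s * y i) - s * p y" if "s \<ge> 0" for u s
    unfolding r_def using that by (intro cInf_lower bdd) (auto simp: S_def)
  have "r (\<lambda>i. u i + v i) \<le> r u + r v" for u v
  proof -
    have "r (\<lambda>i. u i + v i) - a \<le> b" if ab: "a \<in> S u" "b \<in> S v" for a b
    proof -
      obtain s s' where s: "s \<ge> 0" "a = p (\<lambda>i. u i + s * y i) - s * p y"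
        and s': "s' \<ge> 0" "b = p (\<lambda>i. v i + s' * y i) - s' * p y"
        using ab by (auto simp: S_def)
      have "r (\<lambda>i. u i + v i) \<le> p (\<lambda>i. u i + v i + (s + s') * y i) - (s + s') * p y"
        using s s' by (intro r_le) simp
      also have "(\<lambda>i. u i + v i + (s + s') * y i) = (\<lambda>i. (u i + s * y i) + (v i + s' * y i))"
        by (auto simp: algebra_simps)
      also have "p \<dots> \<le> p (\<lambda>i. u i + s * y i) + p (\<lambda>i. v i + s' * y i)"
        by (rule sublinear_add[OF p])
      finally show ?thesis using s s' by (simp add: algebra_simps)
    qed
    then have "r (\<lambda>i. u i + v i) - a \<le> r v" if "a \<in> S u" for a
      unfolding r_def[of v] using that ne by (intro cInf_greatest) auto
    then have "r (\<lambda>i. u i + v i) - r v \<le> a" if "a \<in> S u" for a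
      using that by fastforce
    then have "r (\<lambda>i. u i + v i) - r v \<le> r u"
      unfolding r_def[of u] using ne by (intro cInf_greatest) auto
    then show ?thesis by simp
  qed
  moreover have "r (\<lambda>i. c * u i) \<le> c * r u" if c: "c > 0" for c u
  proof -
    have "r (\<lambda>i. c * u i) / c \<le> a" if a: "a \<in> S u" for a
    proof -
      obtain s where s: "s \<ge> 0" "a = p (\<lambda>i. u i + s * y i) - s * p y"
        using a by (auto simp: S_def)
      have "r (\<lambda>i. c * u i) \<le> p (\<lambda>i. c * u i + (c * s) * y i) - (c * s) * p y"
        using s c by (intro r_le) simp
      also have "(\<lambda>i. c * u i + (c * s) * y i) = (\<lambda>i. c * (u i + s * y i))"
        by (auto simp: algebra_simps)
      also have "p \<dots> \<le> c * p (\<lambda>i. u i + s * y i)" by (rule sublinear_scale[OF p c])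
      also have "p (\<lambda>i. u i + s * y i) = a + s * p y" using s by simp
      finally have "r (\<lambda>i. c * u i) \<le> c * a" by (simp add: algebra_simps)
      then show ?thesis using c by (simp add: field_simps)
    qed
    then have "r (\<lambda>i. c * u i) / c \<le> r u"
      unfolding r_def[of u] using ne by (intro cInf_greatest) auto
    then show ?thesis using c by (simp add: field_simps)
  qed
  moreover have "r u \<le> p u" for u using r_le[of 0 u] by simp
  moreover have "r (\<lambda>i. - y i) \<le> - p y"
    using r_le[of 1 "\<lambda>i. - y i"] sublinear_zero[OF p] by simp
  ultimately show ?thesis unfolding sublinear_def by blast
qed

lemma sublinear_linear_on_finite:
  assumes "finite Y" and "sublinear p"
  shows "\<exists>r. sublinear r \<and> (\<forall>u. r u \<le> p u) \<and> (\<forall>y\<in>Y. r (\<lambda>i. - y i) \<le> - r y)"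
  using assms(1)
proof (induction Y)
  case empty
  then show ?case using assms(2) by auto
next
  case (insert y Y)
  then obtain r where r: "sublinear r" "\<And>u. r u \<le> p u" "\<And>z. z \<in> Y \<Longrightarrow> r (\<lambda>i. - z i) \<le> - r z"
    by blast
  obtain r' where r': "sublinear r'" "\<And>u. r' u \<le> r u" "r' (\<lambda>i. - y i) \<le> - r y"
    using sublinear_linear_along[OF r(1)] by blast
  \<comment> \<open>Linearity along earlier vectors survives lowering:
    \<open>r' (- z) \<le> r (- z) \<le> - r z \<le> - r' z\<close>.\<close>
  have "r' (\<lambda>i. - z i) \<le> - r' z" if "z \<in> insert y Y" for z
    using that r'(2)[of z] r'(2)[of "\<lambda>i. - z i"] r'(3) r(3)[of z] by fastforce
  then show ?case using r' r(2) by (meson order_trans)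
qed

text \<open>Finite-dimensional Hahn-Banach: \<open>p\<close> is lowered until it is linear along
  each coordinate vector, and the values there are the coefficients.\<close>

lemma dominated_functional:
  fixes p :: "('i \<Rightarrow> real) \<Rightarrow> real" and J :: "'i \<Rightarrow> real"
  assumes p: "sublinear p" and fin: "finite I"
    and local: "\<forall>u v. (\<forall>i\<in>I. u i = v i) \<longrightarrow> p u = p v"
  shows "\<exists>a. (\<forall>u. (\<Sum>i\<in>I. a i * u i) \<le> p u) \<and> p J \<le> (\<Sum>i\<in>I. a i * J i)"
proof -
  define \<delta> :: "'i \<Rightarrow> 'i \<Rightarrow> real" where "\<delta> i = (\<lambda>j. if j = i then 1 else 0)" for i
  define R where "R u = (\<lambda>j. \<Sum>i\<in>I. u i * \<delta> i j)" for u
  have R: "R u j = u j" if "j \<in> I" for u j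
    using that fin by (simp add: R_def \<delta>_def if_distrib cong: if_cong)
  have Rneg: "R (\<lambda>i. - u i) = (\<lambda>j. - R u j)" for u
    by (simp add: R_def sum_negf)
  have pR: "p (R u) = p u" for u
    using R local by blast
  \<comment> \<open>Treating \<open>J\<close> first makes every linear functional below
    \<open>p'\<close> reach \<open>p J\<close> at \<open>J\<close>.\<close>
  obtain p' where p': "sublinear p'" "\<And>u. p' u \<le> p u" "p' (\<lambda>i. - R J i) \<le> - p (R J)"
    using sublinear_linear_along[OF p] by blast
  obtain r where r: "sublinear r" "\<And>u. r u \<le> p' u" "\<And>i. i \<in> I \<Longrightarrow> r (\<lambda>j. - \<delta> i j) \<le> - r (\<delta> i)"
    using sublinear_linear_on_finite[OF finite_imageI[OF fin, of \<delta>] p'(1)] by auto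
  have coord: "r (\<lambda>j. c * \<delta> i j) \<le> r (\<delta> i) * c" if i: "i \<in> I" for i c
  proof -
    consider "c > 0" | "c = 0" | "c < 0" by linarith
    then show ?thesis
    proof cases
      case 1 then show ?thesis using sublinear_scale[OF r(1), of c "\<delta> i"] by (simp add: mult.commute)
    next
      case 2 then show ?thesis using sublinear_zero[OF r(1)] by simp
    next
      case 3
      have "r (\<lambda>j. (-c) * (- \<delta> i j)) \<le> (-c) * r (\<lambda>j. - \<delta> i j)"
        using 3 by (intro sublinear_scale[OF r(1)]) auto
      also have "\<dots> \<le> (-c) * (- r (\<delta> i))"
        using 3 r(3)[OF i] by (intro mult_left_mono) auto
      finally show ?thesis by (simp add: mult.commute)
    qed
  qed
  have le: "r (\<lambda>j. \<Sum>i\<in>K. u i * \<delta> i j) \<le> (\<Sum>i\<in>K. r (\<delta> i) * u i)" if "K \<subseteq> I" for K u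
    using finite_subset[OF that fin] that
  proof (induction K)
    case empty
    then show ?case using sublinear_zero[OF r(1)] by simp
  next
    case (insert k K)
    have "r (\<lambda>j. \<Sum>i\<in>insert k K. u i * \<delta> i j) = r (\<lambda>j. u k * \<delta> k j + (\<Sum>i\<in>K. u i * \<delta> i j))"
      using insert by simp
    also have "\<dots> \<le> r (\<lambda>j. u k * \<delta> k j) + r (\<lambda>j. \<Sum>i\<in>K. u i * \<delta> i j)"
      by (rule sublinear_add[OF r(1)])
    finally show ?case using insert coord[of k "u k"] by auto
  qed
  \<comment> \<open>The upper bound \<open>le\<close> at \<open>- u\<close> becomes a lower bound at
    \<open>u\<close>, since \<open>0 \<le> r (R u) + r (- R u)\<close>.\<close>
  have lower: "(\<Sum>i\<in>I. r (\<delta> i) * u i) \<le> r (R u)" for u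
    using le[of I "\<lambda>i. - u i"] sublinear_minus[OF r(1), of "R u"] Rneg[of u]
    by (simp add: R_def sum_negf)
  show ?thesis
  proof (intro exI[of _ "\<lambda>i. r (\<delta> i)"] conjI allI)
    show "(\<Sum>i\<in>I. r (\<delta> i) * u i) \<le> p u" for u
      using lower[of u] r(2)[of "R u"] p'(2)[of "R u"] pR[of u] by linarith
    show "p J \<le> (\<Sum>i\<in>I. r (\<delta> i) * J i)"
      using lower[of "\<lambda>i. - J i"] r(2)[of "R (\<lambda>i. - J i)"] p'(3) pR[of J]
      by (simp add: Rneg sum_negf)
  qed
qed

subsection \<open>Gram matrices\<close>

text \<open>Positive semidefiniteness is encoded as a finite sum of rank-one terms, so that closure
  properties become inductions.\<close>

inductive gram :: "('a \<Rightarrow> 'a \<Rightarrow> real) \<Rightarrow> bool" where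
  gram_zero: "gram (\<lambda>x y. 0)"
| gram_add_rank1: "gram P \<Longrightarrow> gram (\<lambda>x y. P x y + w x * w y)"

lemma gram_rank1: "gram (\<lambda>x y. w x * w y)"
  using gram_add_rank1[OF gram_zero, of w] by simp

lemma gram_add:
  assumes "gram P" "gram Q"
  shows "gram (\<lambda>x y. P x y + Q x y)"
  using assms(2)
proof (induction Q)
  case gram_zero
  then show ?case using assms(1) by simp
next
  case (gram_add_rank1 Q w)
  then show ?case using gram.gram_add_rank1[of "\<lambda>x y. P x y + Q x y" w] by (simp add: add.assoc)
qed

lemma gram_sum:
  assumes "finite K" and "\<And>k. k \<in> K \<Longrightarrow> gram (P k)"
  shows "gram (\<lambda>x y. \<Sum>k\<in>K. P k x y)"
  using assms by (induction K) (auto intro: gram_zero gram_add)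

lemma gram_scale:
  assumes "gram P" "c \<ge> 0"
  shows "gram (\<lambda>x y. c * P x y)"
  using assms(1)
proof (induction P)
  case gram_zero
  then show ?case using gram.gram_zero by simp
next
  case (gram_add_rank1 P w)
  have "gram (\<lambda>x y. c * P x y + (sqrt c * w x) * (sqrt c * w y))"
    by (rule gram.gram_add_rank1[OF gram_add_rank1.IH])
  also have "(\<lambda>x y. c * P x y + (sqrt c * w x) * (sqrt c * w y)) = (\<lambda>x y. c * (P x y + w x * w y))"
  proof (intro ext)
    fix x y
    have "sqrt c * w x * (sqrt c * w y) = (sqrt c * sqrt c) * (w x * w y)" by (simp only: mult_ac)
    then show "c * P x y + (sqrt c * w x) * (sqrt c * w y) = c * (P x y + w x * w y)"
      using assms(2) by (simp add: distrib_left)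
  qed
  finally show ?case .
qed

lemma gram_mult_rank1:
  assumes "gram P"
  shows "gram (\<lambda>x y. P x y * (v x * v y))"
  using assms
proof (induction P)
  case gram_zero
  then show ?case using gram.gram_zero by simp
next
  case (gram_add_rank1 P w)
  then show ?case
    using gram.gram_add_rank1[OF gram_add_rank1.IH, of "\<lambda>x. w x * v x"] by (simp add: algebra_simps)
qed

text \<open>Schur product theorem: each rank-one term of \<open>Q\<close> rescales the rows and
  columns of \<open>P\<close>, which keeps it Gram.\<close>

lemma gram_mult:
  assumes "gram P" "gram Q"
  shows "gram (\<lambda>x y. P x y * Q x y)"
  using assms(2)
proof (induction Q)
  case gram_zero
  then show ?case using gram.gram_zero by simp
next
  case (gram_add_rank1 Q w)
  then show ?case
    using gram_add[OF gram_add_rank1.IH gram_mult_rank1[OF assms(1), of w]] by (simp add: algebra_simps)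
qed

lemma gram_diag_nonneg: "gram P \<Longrightarrow> 0 \<le> P x x"
  by (induction P rule: gram.induct) auto

text \<open>This is the quadratic form at the indicator vector of \<open>V\<close>; each rank-one
  term contributes a square.\<close>

lemma gram_sum_nonneg: "gram P \<Longrightarrow> 0 \<le> (\<Sum>x\<in>V. \<Sum>y\<in>V. P x y)"
proof (induction P rule: gram.induct)
  case (gram_add_rank1 P w)
  have "(\<Sum>x\<in>V. \<Sum>y\<in>V. w x * w y) = (\<Sum>x\<in>V. w x)\<^sup>2"
    by (simp add: sum_product power2_eq_square)
  then show ?case using gram_add_rank1.IH by (simp add: sum.distrib)
qed auto

text \<open>A further factor gives \<open>(1 + Q) * (1 + P) - 1 = Q + P + Q * P\<close> entrywise, a
  sum of Gram matrices.\<close>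

lemma gram_prod:
  fixes P :: "nat \<Rightarrow> 'a \<Rightarrow> 'a \<Rightarrow> real"
  assumes "\<And>i. i < q \<Longrightarrow> gram (P i)"
  shows "gram (\<lambda>x y. (\<Prod>i<q. 1 + P i x y) - 1)"
  using assms
proof (induction q)
  case 0
  then show ?case by (simp add: gram_zero)
next
  case (Suc q)
  let ?Q = "\<lambda>x y. (\<Prod>i<q. 1 + P i x y) - 1"
  have "gram ?Q" "gram (P q)" using Suc by auto
  then have "gram (\<lambda>x y. ?Q x y + P q x y + ?Q x y * P q x y)"
    by (intro gram_add gram_mult)
  then show ?case by (simp add: algebra_simps)
qed

text \<open>Some factor vanishes at each pair of distinct vertices, so the product is diagonal with
  entries at most \<open>t ^ q\<close>. Its excess over the all-ones matrix has nonnegative entry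
  sum, whence \<open>N * N \<le> N * t ^ q\<close> for \<open>N = card V\<close>.\<close>

lemma card_le_power:
  fixes P :: "nat \<Rightarrow> 'a \<Rightarrow> 'a \<Rightarrow> real"
  assumes fin: "finite V" and ne: "V \<noteq> {}" and P: "\<And>i. i < q \<Longrightarrow> gram (P i)"
    and diag: "\<And>i x. i < q \<Longrightarrow> x \<in> V \<Longrightarrow> 1 + P i x x \<le> t"
    and edge: "\<And>x y. x \<in> V \<Longrightarrow> y \<in> V \<Longrightarrow> x \<noteq> y \<Longrightarrow> \<exists>i<q. 1 + P i x y = 0"
  shows "real (card V) \<le> t ^ q"
proof -
  have "0 \<le> (\<Sum>x\<in>V. \<Sum>y\<in>V. (\<Prod>i<q. 1 + P i x y) - 1)"
    by (rule gram_sum_nonneg[OF gram_prod[OF P]])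
  also have "\<dots> = (\<Sum>x\<in>V. \<Sum>y\<in>V. (\<Prod>i<q. 1 + P i x y)) - real (card V) * real (card V)"
    by (simp add: sum_subtractf)
  also have "(\<Sum>x\<in>V. \<Sum>y\<in>V. (\<Prod>i<q. 1 + P i x y)) = (\<Sum>x\<in>V. \<Prod>i<q. 1 + P i x x)"
  proof (rule sum.cong[OF refl])
    fix x assume x: "x \<in> V"
    have "(\<Prod>i<q. 1 + P i x y) = 0" if "y \<in> V - {x}" for y
      using edge[of x y] that x by (auto intro: prod_zero)
    then have "(\<Sum>y\<in>V - {x}. (\<Prod>i<q. 1 + P i x y)) = 0"
      by (rule sum.neutral[OF ballI])
    then show "(\<Sum>y\<in>V. (\<Prod>i<q. 1 + P i x y)) = (\<Prod>i<q. 1 + P i x x)"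
      by (simp only: sum.remove[OF fin x] add_0_right)
  qed
  also have "\<dots> \<le> (\<Sum>x\<in>V. t ^ q)"
  proof (rule sum_mono)
    fix x assume x: "x \<in> V"
    have "(\<Prod>i<q. 1 + P i x x) \<le> (\<Prod>i<q. t)"
      using diag[OF _ x] gram_diag_nonneg[OF P] by (intro prod_mono) (auto simp: add_nonneg_nonneg)
    then show "(\<Prod>i<q. 1 + P i x x) \<le> t ^ q" by simp
  qed
  finally have "real (card V) * real (card V) \<le> real (card V) * t ^ q" by simp
  moreover have "0 < real (card V)" using fin ne by (simp add: card_gt_0_iff)
  ultimately show ?thesis using mult_le_cancel_left_pos by blast
qed

subsection \<open>Semidefinite duality\<close>

definition ip :: "'a set \<Rightarrow> ('a \<Rightarrow> real) \<Rightarrow> ('a \<Rightarrow> real) \<Rightarrow> real" where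
  "ip V u v = (\<Sum>x\<in>V. u x * v x)"

definition mv :: "'a set \<Rightarrow> ('a \<Rightarrow> 'a \<Rightarrow> real) \<Rightarrow> ('a \<Rightarrow> real) \<Rightarrow> 'a \<Rightarrow> real" where
  "mv V B v = (\<lambda>x. \<Sum>y\<in>V. B x y * v y)"

lemma ip_mv: "ip V u (mv V B v) = (\<Sum>x\<in>V. \<Sum>y\<in>V. B x y * (u x * v y))"
  by (simp add: ip_def mv_def sum_distrib_left mult_ac)

text \<open>The last clause says that \<open>I + B\<close> is positive semidefinite on
  \<open>V\<close>: the eigenvalues of \<open>B\<close> there are at least -1.\<close>

definition weighting :: "'a set \<Rightarrow> ('a \<times> 'a) set \<Rightarrow> ('a \<Rightarrow> 'a \<Rightarrow> real) \<Rightarrow> bool" where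
  "weighting V G B \<longleftrightarrow> (\<forall>x y. B x y = B y x) \<and> (\<forall>x y. B x y \<noteq> 0 \<longrightarrow> (x, y) \<in> G) \<and>
    (\<forall>v. 0 \<le> ip V v v + ip V v (mv V B v))"

text \<open>Each ordered pair \<open>p\<close> contributes a rank-one matrix whose entry at that
  pair is \<open>- w p / 2\<close>. This makes the gauge sets below nonempty.\<close>

lemma gram_off_diag:
  fixes w :: "'a \<times> 'a \<Rightarrow> real"
  assumes fin: "finite V"
  shows "\<exists>P. gram P \<and> (\<forall>x\<in>V. \<forall>y\<in>V. x \<noteq> y \<longrightarrow> w (x, y) + w (y, x) + 2 * P x y = 0)"
proof -
  define D where "D = {p \<in> V \<times> V. fst p \<noteq> snd p}"
  define v :: "'a \<times> 'a \<Rightarrow> 'a \<Rightarrow> real" where "v p x = (if x = fst p then 1 else if x = snd p then - sgn (w p) else 0)" for p x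
  define P where "P x y = (\<Sum>p\<in>D. (\<bar>w p\<bar> / 2) * (v p x * v p y))" for x y
  have finD: "finite D" using fin by (auto simp: D_def)
  have "gram P" unfolding P_def[abs_def]
    using finD by (intro gram_sum gram_scale gram_rank1) auto
  moreover have "w (x, y) + w (y, x) + 2 * P x y = 0" if "x \<in> V" "y \<in> V" "x \<noteq> y" for x y
  proof -
    have "P x y = (\<Sum>p\<in>{(x, y), (y, x)}. (\<bar>w p\<bar> / 2) * (v p x * v p y))"
      unfolding P_def using that
      by (intro sum.mono_neutral_right finD) (auto simp: D_def v_def split: if_splits)
    also have "\<dots> = - (\<bar>w (x, y)\<bar> * sgn (w (x, y))) / 2 - (\<bar>w (y, x)\<bar> * sgn (w (y, x))) / 2"
      using that by (auto simp: v_def)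
    finally show ?thesis by (simp add: abs_mult_sgn field_simps)
  qed
  ultimately show ?thesis by blast
qed

text \<open>The infimum of this set is sublinear in \<open>w\<close>; a linear functional below it is a positive
  semidefinite matrix of trace at most 1 supported on \<open>G\<close> and the diagonal. Only the symmetric
  part of \<open>w\<close> matters.\<close>

definition gauge_set :: "'a set \<Rightarrow> ('a \<times> 'a) set \<Rightarrow> ('a \<times> 'a \<Rightarrow> real) \<Rightarrow> real set" where
  "gauge_set V G w = {c. \<exists>P. gram P \<and> (\<forall>x\<in>V. w (x, x) + P x x \<le> c) \<and>
     (\<forall>x\<in>V. \<forall>y\<in>V. x \<noteq> y \<longrightarrow> (x, y) \<in> G \<longrightarrow> w (x, y) + w (y, x) + 2 * P x y = 0)}"

section \<open>Finiteness and sublinearity of the gauge\<close>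

lemma gauge_set_nonempty:
  assumes "finite V" shows "gauge_set V G w \<noteq> {}"
proof -
  obtain P where P: "gram P" "\<And>x y. x \<in> V \<Longrightarrow> y \<in> V \<Longrightarrow> x \<noteq> y \<Longrightarrow> w (x, y) + w (y, x) + 2 * P x y = 0"
    using gram_off_diag[OF assms, of w] by blast
  have "w (x, x) + P x x \<le> (\<Sum>x\<in>V. \<bar>w (x, x) + P x x\<bar>)" if "x \<in> V" for x
    using member_le_sum[OF that, of "\<lambda>x. \<bar>w (x, x) + P x x\<bar>"] assms by simp
  then show ?thesis using P unfolding gauge_set_def by blast
qed

lemma gauge_set_lower:
  assumes "c \<in> gauge_set V G w" "x \<in> V" shows "w (x, x) \<le> c"
proof -
  obtain P where "gram P" "w (x, x) + P x x \<le> c"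
    using assms by (auto simp: gauge_set_def)
  then show ?thesis using gram_diag_nonneg[of P x] by linarith
qed

lemma gauge_set_bdd:
  assumes "V \<noteq> {}" shows "bdd_below (gauge_set V G w)"
proof -
  obtain x where "x \<in> V" using assms by blast
  then show ?thesis using gauge_set_lower[of _ V G w x] by (intro bdd_belowI)
qed

lemma gauge_set_add:
  assumes "c \<in> gauge_set V G w" "d \<in> gauge_set V G z"
  shows "c + d \<in> gauge_set V G (\<lambda>i. w i + z i)"
proof -
  obtain P Q where gr: "gram P" "gram Q"
    and P: "\<And>x. x \<in> V \<Longrightarrow> w (x, x) + P x x \<le> c"
      "\<And>x y. x \<in> V \<Longrightarrow> y \<in> V \<Longrightarrow> x \<noteq> y \<Longrightarrow> (x, y) \<in> G \<Longrightarrow> w (x, y) + w (y, x) + 2 * P x y = 0"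
    and Q: "\<And>x. x \<in> V \<Longrightarrow> z (x, x) + Q x x \<le> d"
      "\<And>x y. x \<in> V \<Longrightarrow> y \<in> V \<Longrightarrow> x \<noteq> y \<Longrightarrow> (x, y) \<in> G \<Longrightarrow> z (x, y) + z (y, x) + 2 * Q x y = 0"
    using assms unfolding gauge_set_def by auto
  have "gram (\<lambda>x y. P x y + Q x y)" by (rule gram_add[OF gr])
  moreover have "w (x, x) + z (x, x) + (P x x + Q x x) \<le> c + d" if "x \<in> V" for x
    using P(1)[OF that] Q(1)[OF that] by linarith
  moreover have "w (x, y) + z (x, y) + (w (y, x) + z (y, x)) + 2 * (P x y + Q x y) = 0"
    if "x \<in> V" "y \<in> V" "x \<noteq> y" "(x, y) \<in> G" for x y
    using P(2)[OF that] Q(2)[OF that] by (simp add: algebra_simps)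
  ultimately show ?thesis unfolding gauge_set_def
    by (intro CollectI exI[of _ "\<lambda>x y. P x y + Q x y"]) simp
qed

lemma gauge_set_scale:
  assumes "c \<in> gauge_set V G w" "s \<ge> 0"
  shows "s * c \<in> gauge_set V G (\<lambda>i. s * w i)"
proof -
  obtain P where gr: "gram P"
    and P: "\<And>x. x \<in> V \<Longrightarrow> w (x, x) + P x x \<le> c"
      "\<And>x y. x \<in> V \<Longrightarrow> y \<in> V \<Longrightarrow> x \<noteq> y \<Longrightarrow> (x, y) \<in> G \<Longrightarrow> w (x, y) + w (y, x) + 2 * P x y = 0"
    using assms unfolding gauge_set_def by auto
  have "gram (\<lambda>x y. s * P x y)" by (rule gram_scale[OF gr assms(2)])
  moreover have "s * w (x, x) + s * P x x \<le> s * c" if "x \<in> V" for x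
    using mult_left_mono[OF P(1)[OF that] assms(2)] by (simp add: algebra_simps)
  moreover have "s * w (x, y) + s * w (y, x) + 2 * (s * P x y) = 0"
    if "x \<in> V" "y \<in> V" "x \<noteq> y" "(x, y) \<in> G" for x y
  proof -
    have "s * w (x, y) + s * w (y, x) + 2 * (s * P x y) = s * (w (x, y) + w (y, x) + 2 * P x y)"
      by (simp add: algebra_simps)
    then show ?thesis using P(2)[OF that] by simp
  qed
  ultimately show ?thesis unfolding gauge_set_def
    by (intro CollectI exI[of _ "\<lambda>x y. s * P x y"]) simp
qed

lemma gauge_sublinear:
  assumes "finite V" "V \<noteq> {}"
  shows "sublinear (\<lambda>w. Inf (gauge_set V G w))"
  unfolding sublinear_def
proof (intro conjI allI impI)
  note ne = gauge_set_nonempty[OF assms(1)] and bdd = gauge_set_bdd[OF assms(2)]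
  fix w z :: "'a \<times> 'a \<Rightarrow> real"
  let ?p = "\<lambda>w. Inf (gauge_set V G w)"
  have "?p (\<lambda>i. w i + z i) - d \<le> ?p w" if "d \<in> gauge_set V G z" for d
  proof (rule cInf_greatest[OF ne])
    fix c assume "c \<in> gauge_set V G w"
    then show "?p (\<lambda>i. w i + z i) - d \<le> c"
      using cInf_lower[OF gauge_set_add[OF _ that] bdd] by (simp add: algebra_simps)
  qed
  then have "?p (\<lambda>i. w i + z i) - ?p w \<le> d" if "d \<in> gauge_set V G z" for d
    using that by fastforce
  then have "?p (\<lambda>i. w i + z i) - ?p w \<le> ?p z"
    by (intro cInf_greatest[OF ne])
  then show "?p (\<lambda>i. w i + z i) \<le> ?p w + ?p z" by simp
next
  note ne = gauge_set_nonempty[OF assms(1)] and bdd = gauge_set_bdd[OF assms(2)]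
  fix w :: "'a \<times> 'a \<Rightarrow> real" and c :: real
  assume c: "c > 0"
  let ?p = "\<lambda>w. Inf (gauge_set V G w)"
  have "?p (\<lambda>i. c * w i) / c \<le> ?p w"
  proof (rule cInf_greatest[OF ne])
    fix d assume d: "d \<in> gauge_set V G w"
    have "c * d \<in> gauge_set V G (\<lambda>i. c * w i)" by (rule gauge_set_scale[OF d less_imp_le[OF c]])
    from cInf_lower[OF this bdd] show "?p (\<lambda>i. c * w i) / c \<le> d"
      using c by (simp add: field_simps)
  qed
  then show "?p (\<lambda>i. c * w i) \<le> c * ?p w" using c by (simp add: field_simps)
qed

text \<open>Infeasibility at \<open>t\<close> puts the gauge of the all-ones function at
  \<open>t\<close> or above; \<open>M\<close> is the symmetrised functional attaining that gauge.
  Its other properties come from testing the functional on functions of visibly small gauge.\<close>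

lemma dual_matrix:
  fixes G :: "('a \<times> 'a) set"
  assumes fin: "finite V" and ne: "V \<noteq> {}" and sym: "sym G"
    and no_P: "\<not> (\<exists>P. gram P \<and> (\<forall>x\<in>V. 1 + P x x \<le> t) \<and>
      (\<forall>x\<in>V. \<forall>y\<in>V. x \<noteq> y \<longrightarrow> (x, y) \<in> G \<longrightarrow> 1 + P x y = 0))"
  obtains M where "\<And>x y. M x y = M y x"
    and "\<And>x y. x \<noteq> y \<Longrightarrow> M x y \<noteq> 0 \<Longrightarrow> (x, y) \<in> G"
    and "\<And>w. 0 \<le> (\<Sum>x\<in>V. \<Sum>y\<in>V. M x y * (w x * w y))"
    and "(\<Sum>x\<in>V. M x x) \<le> 1" and "t \<le> (\<Sum>x\<in>V. \<Sum>y\<in>V. M x y)"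
proof -
  let ?p = "\<lambda>w. Inf (gauge_set V G w)"
  have local: "\<forall>u v. (\<forall>i\<in>V \<times> V. u i = v i) \<longrightarrow> ?p u = ?p v"
    by (simp add: gauge_set_def)
  obtain a where a: "\<And>u. (\<Sum>i\<in>V \<times> V. a i * u i) \<le> ?p u"
    and aJ: "?p (\<lambda>i. 1) \<le> (\<Sum>i\<in>V \<times> V. a i * 1)"
    using dominated_functional[OF gauge_sublinear[OF fin ne, of G]
        finite_cartesian_product[OF fin fin] local, of "\<lambda>i. 1"] by blast
  have a_le': "(\<Sum>i\<in>V \<times> V. a i * u i) \<le> c" if "c \<in> gauge_set V G u" for u c
    by (rule order_trans[OF a cInf_lower[OF that gauge_set_bdd[OF ne]]])
  have a_le: "(\<Sum>x\<in>V. \<Sum>y\<in>V. a (x, y) * u (x, y)) \<le> c" if "c \<in> gauge_set V G u" for u c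
    using a_le'[OF that] by (simp add: sum.cartesian_product split_def)
  define M where "M x y = (if x \<in> V \<and> y \<in> V then (a (x, y) + a (y, x)) / 2 else 0)" for x y
  have Msum: "(\<Sum>x\<in>V. \<Sum>y\<in>V. M x y * u x y) = (\<Sum>x\<in>V. \<Sum>y\<in>V. a (x, y) * u x y)"
    if "\<And>x y. u x y = u y x" for u
  proof -
    have "(\<Sum>x\<in>V. \<Sum>y\<in>V. M x y * u x y)
        = (\<Sum>x\<in>V. \<Sum>y\<in>V. a (x, y) * u x y / 2) + (\<Sum>x\<in>V. \<Sum>y\<in>V. a (y, x) * u x y / 2)"
      by (simp add: M_def add_divide_distrib distrib_right flip: sum.distrib)
    also have "(\<Sum>x\<in>V. \<Sum>y\<in>V. a (y, x) * u x y / 2) = (\<Sum>x\<in>V. \<Sum>y\<in>V. a (x, y) * u x y / 2)"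
      by (subst sum.swap) (simp add: that)
    finally show ?thesis by (simp flip: sum_divide_distrib sum.distrib)
  qed
  have off: "a (x, y) = 0" if xy: "x \<in> V" "y \<in> V" "x \<noteq> y" "(x, y) \<notin> G" for x y
  proof -
    have yx: "(y, x) \<notin> G" using sym xy by (auto dest: symD)
    \<comment> \<open>A non-edge is unconstrained, so \<open>P = 0\<close> is admissible and the
      gauge is at most 0 for either sign of \<open>s\<close>.\<close>
    have "a (x, y) * s \<le> 0" for s
    proof -
      have "0 \<in> gauge_set V G (\<lambda>i. if i = (x, y) then s else 0)"
        unfolding gauge_set_def using xy yx
        by (intro CollectI exI[of _ "\<lambda>x y. 0"]) (auto simp: gram_zero)
      from a_le'[OF this] show ?thesis
        using fin xy by (simp add: if_distrib cong: if_cong)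
    qed
    from this[of 1] this[of "-1"] show ?thesis by simp
  qed
  show ?thesis
  proof (rule that[of M])
    show "M x y = M y x" for x y by (simp add: M_def)
    show "(x, y) \<in> G" if "x \<noteq> y" "M x y \<noteq> 0" for x y
      using that off[of x y] off[of y x] symD[OF sym, of y x]
      by (cases "(x, y) \<in> G") (auto simp: M_def split: if_splits)
    show "0 \<le> (\<Sum>x\<in>V. \<Sum>y\<in>V. M x y * (w x * w y))" for w
    proof -
      \<comment> \<open>The rank-one matrix of \<open>w\<close> cancels its own negative, so the
        gauge is at most 0.\<close>
      have "0 \<in> gauge_set V G (\<lambda>i. - (w (fst i) * w (snd i)))"
        unfolding gauge_set_def
        by (intro CollectI exI[of _ "\<lambda>x y. w x * w y"]) (auto simp: gram_rank1)
      from a_le[OF this] show ?thesis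
        by (subst Msum) (auto simp: sum_negf mult.commute)
    qed
    \<comment> \<open>The identity matrix has gauge at most 1, which caps the trace.\<close>
    have "1 \<in> gauge_set V G (\<lambda>i. if fst i = snd i then 1 else 0)"
      unfolding gauge_set_def
      by (intro CollectI exI[of _ "\<lambda>x y. 0"]) (auto simp: gram_zero)
    from a_le[OF this] show "(\<Sum>x\<in>V. M x x) \<le> 1"
      using fin by (simp add: M_def if_distrib cong: if_cong)
    have "t \<le> ?p (\<lambda>i. 1)"
    proof (rule cInf_greatest[OF gauge_set_nonempty[OF fin]])
      fix c assume "c \<in> gauge_set V G (\<lambda>i. 1)"
      then obtain P where gr: "gram P" and P: "\<And>x. x \<in> V \<Longrightarrow> 1 + P x x \<le> c"
        "\<And>x y. x \<in> V \<Longrightarrow> y \<in> V \<Longrightarrow> x \<noteq> y \<Longrightarrow> (x, y) \<in> G \<Longrightarrow> 1 + 1 + 2 * P x y = 0"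
        unfolding gauge_set_def by blast
      show "t \<le> c"
      proof (rule ccontr)
        assume "\<not> t \<le> c"
        then have "\<forall>x\<in>V. 1 + P x x \<le> t" using P(1) by force
        moreover have "1 + P x y = 0" if "x \<in> V" "y \<in> V" "x \<noteq> y" "(x, y) \<in> G" for x y
          using P(2)[OF that] by simp
        ultimately show False using no_P gr by blast
      qed
    qed
    also have "\<dots> \<le> (\<Sum>x\<in>V. \<Sum>y\<in>V. M x y)"
      using aJ Msum[of "\<lambda>x y. 1"] by (simp add: sum.cartesian_product split_def)
    finally show "t \<le> (\<Sum>x\<in>V. \<Sum>y\<in>V. M x y)" .
  qed
qed

text \<open>Gives access to two-by-two principal minors: a zero diagonal entry forces a zero row,
  and later a unit diagonal bounds the other entries.\<close>

lemma quadratic_form_pair: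
  fixes M :: "'a \<Rightarrow> 'a \<Rightarrow> real"
  assumes fin: "finite V" and xy: "x \<in> V" "y \<in> V" "x \<noteq> y" and sym: "M x y = M y x"
    and w: "w = (\<lambda>z. if z = x then c else if z = y then d else 0)"
  shows "(\<Sum>a\<in>V. \<Sum>b\<in>V. M a b * (w a * w b)) = M x x * c\<^sup>2 + 2 * M x y * c * d + M y y * d\<^sup>2"
proof -
  have inner: "(\<Sum>b\<in>V. M a b * (w a * w b)) = w a * (M a x * c + M a y * d)" for a
  proof -
    have "(\<Sum>b\<in>V. M a b * (w a * w b)) = (\<Sum>b\<in>{x, y}. M a b * (w a * w b))"
      using xy fin by (intro sum.mono_neutral_right) (auto simp: w)
    then show ?thesis using xy by (auto simp: w algebra_simps)
  qed
  have "(\<Sum>a\<in>V. w a * (M a x * c + M a y * d)) = (\<Sum>a\<in>{x, y}. w a * (M a x * c + M a y * d))"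
    using xy fin by (intro sum.mono_neutral_right) (auto simp: w)
  then show ?thesis
    using xy sym unfolding inner by (auto simp: w algebra_simps power2_eq_square)
qed

text \<open>\<open>M\<close> is rescaled to unit diagonal and the identity removed, giving
  \<open>B\<close>; \<open>u\<close> is the square root of the diagonal of \<open>M\<close>. Then
  \<open>ip V u u\<close> is the trace of \<open>M\<close>, and adding
  \<open>ip V u (mv V B u)\<close> gives its entry sum.\<close>

lemma dual_weighting:
  fixes G :: "('a \<times> 'a) set"
  assumes fin: "finite V" and ne: "V \<noteq> {}" and sym: "sym G"
    and no_P: "\<not> (\<exists>P. gram P \<and> (\<forall>x\<in>V. 1 + P x x \<le> t) \<and>
      (\<forall>x\<in>V. \<forall>y\<in>V. x \<noteq> y \<longrightarrow> (x, y) \<in> G \<longrightarrow> 1 + P x y = 0))"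
  obtains B u where "weighting V G B" and "ip V u u \<le> 1"
    and "t \<le> ip V u u + ip V u (mv V B u)"
proof -
  obtain M where M_sym: "\<And>x y. M x y = M y x"
    and M_supp: "\<And>x y. x \<noteq> y \<Longrightarrow> M x y \<noteq> 0 \<Longrightarrow> (x, y) \<in> G"
    and M_psd: "\<And>w. 0 \<le> (\<Sum>x\<in>V. \<Sum>y\<in>V. M x y * (w x * w y))"
    and M_tr: "(\<Sum>x\<in>V. M x x) \<le> 1" and M_sum: "t \<le> (\<Sum>x\<in>V. \<Sum>y\<in>V. M x y)"
    using dual_matrix[OF assms] by blast
  have diag_nonneg: "0 \<le> M x x" if x: "x \<in> V" for x
  proof -
    have "M a b * ((if a = x then 1 else 0) * (if b = x then 1 else 0))
        = (if b = x then if a = x then M x x else 0 else 0)" for a b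
      by simp
    then show ?thesis using M_psd[of "\<lambda>a. if a = x then 1 else 0"] fin x by simp
  qed
  have row_zero: "M x y = 0" if xy: "x \<in> V" "y \<in> V" and x0: "M x x = 0" for x y
  proof (rule ccontr)
    assume nz: "M x y \<noteq> 0"
    then have "x \<noteq> y" using x0 by auto
    \<comment> \<open>Chosen so that \<open>2 * M x y * c + M y y = -1\<close>.\<close>
    define c where "c = - (M y y + 1) / (2 * M x y)"
    have "0 \<le> M x x * c\<^sup>2 + 2 * M x y * c * 1 + M y y * 1\<^sup>2"
      using M_psd[of "\<lambda>z. if z = x then c else if z = y then 1 else 0"]
      unfolding quadratic_form_pair[OF fin xy \<open>x \<noteq> y\<close> M_sym refl] .
    also have "\<dots> = -1" using nz x0 by (simp add: c_def)
    finally show False by simp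
  qed
  define s where "s x = sqrt (M x x)" for x
  \<comment> \<open>Division by zero yields 0, so \<open>B\<close> vanishes in the rows and columns
    where \<open>s\<close> does; by \<open>row_zero\<close>, so does \<open>M\<close>.\<close>
  define B where "B x y = (if x = y then 0 else M x y / (s x * s y))" for x y
  have s_sq: "s x * s x = M x x" if "x \<in> V" for x
    using diag_nonneg[OF that] by (simp add: s_def)
  have "0 \<le> ip V v v + ip V v (mv V B v)" for v
  proof -
    define w where "w x = v x / s x" for x
    \<comment> \<open>Equality fails at most on the diagonal where \<open>s x = 0\<close>: there the
      left side is 0 and the right side is \<open>v x * v x\<close>.\<close>
    have "M x y * (w x * w y) \<le> (if x = y then v x * v y else 0) + B x y * (v x * v y)"
      if "x \<in> V" "y \<in> V" for x y
    proof (cases "x = y")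
      case True
      show ?thesis
      proof (cases "s x = 0")
        case False
        then show ?thesis using True s_sq[OF that(1)]
          by (simp add: w_def B_def flip: s_sq[OF that(1)])
      qed (use True in \<open>simp add: w_def B_def\<close>)
    qed (simp add: w_def B_def)
    then have "(\<Sum>x\<in>V. \<Sum>y\<in>V. M x y * (w x * w y))
        \<le> (\<Sum>x\<in>V. \<Sum>y\<in>V. (if x = y then v x * v y else 0) + B x y * (v x * v y))"
      by (intro sum_mono)
    also have "\<dots> = ip V v v + ip V v (mv V B v)"
      using fin by (simp add: ip_mv sum.distrib) (simp add: ip_def)
    finally show ?thesis using M_psd[of w] by linarith
  qed
  moreover have "B x y = B y x" for x y using M_sym[of x y] by (auto simp: B_def)
  moreover have "(x, y) \<in> G" if "B x y \<noteq> 0" for x y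
    using that M_supp[of x y] by (auto simp: B_def split: if_splits)
  ultimately have "weighting V G B" by (simp add: weighting_def)
  moreover have ip_s: "ip V s s = (\<Sum>x\<in>V. M x x)"
    unfolding ip_def using s_sq by (intro sum.cong) auto
  moreover have "ip V s s + ip V s (mv V B s) = (\<Sum>x\<in>V. \<Sum>y\<in>V. M x y)"
  proof -
    have "(if x = y then s x * s y else 0) + B x y * (s x * s y) = M x y" if "x \<in> V" "y \<in> V" for x y
    proof (cases "s x = 0 \<or> s y = 0")
      case True
      then have "M x y = 0"
        using row_zero[of x y] row_zero[of y x] M_sym[of x y] that by (auto simp: s_def)
      then show ?thesis using True by auto
    next
      case False
      then show ?thesis using s_sq that by (auto simp: B_def)
    qed
    then have "(\<Sum>x\<in>V. \<Sum>y\<in>V. M x y)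
        = (\<Sum>x\<in>V. \<Sum>y\<in>V. (if x = y then s x * s y else 0) + B x y * (s x * s y))"
      by (intro sum.cong) auto
    also have "\<dots> = ip V s s + ip V s (mv V B s)"
      using fin by (simp add: ip_mv sum.distrib) (simp add: ip_def)
    finally show ?thesis by simp
  qed
  ultimately show ?thesis using that[of B s] M_tr M_sum by simp
qed

subsection \<open>Iterating the third Chebyshev polynomial\<close>

definition mm :: "'a set \<Rightarrow> ('a \<Rightarrow> 'a \<Rightarrow> real) \<Rightarrow> ('a \<Rightarrow> 'a \<Rightarrow> real) \<Rightarrow> 'a \<Rightarrow> 'a \<Rightarrow> real" where
  "mm V A C x y = (\<Sum>z\<in>V. A x z * C z y)"

definition cheb :: "'a set \<Rightarrow> ('a \<Rightarrow> 'a \<Rightarrow> real) \<Rightarrow> 'a \<Rightarrow> 'a \<Rightarrow> real" where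
  "cheb V B x y = 4 * mm V B (mm V B B) x y - 3 * B x y"

definition T3 :: "real \<Rightarrow> real" where "T3 a = 4 * a ^ 3 - 3 * a"

text \<open>Contains the support of every odd polynomial of degree at most \<open>k\<close> in a
  matrix supported on \<open>G\<close>; a pair \<open>(x, x)\<close> records a closed walk of odd
  length.\<close>

definition odd_walks :: "('a \<times> 'a) set \<Rightarrow> nat \<Rightarrow> ('a \<times> 'a) set" where
  "odd_walks G k = {(x, y). \<exists>n\<le>k. odd n \<and> (x, y) \<in> G ^^ n}"

lemma mv_mm: "mv V (mm V A C) v = mv V A (mv V C v)"
proof
  fix x
  have "mv V (mm V A C) v x = (\<Sum>y\<in>V. \<Sum>z\<in>V. A x z * (C z y * v y))"
    by (simp add: mv_def mm_def sum_distrib_right mult.assoc)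
  also have "\<dots> = mv V A (mv V C v) x"
    by (subst sum.swap) (simp add: mv_def sum_distrib_left)
  finally show "mv V (mm V A C) v x = mv V A (mv V C v) x" .
qed

lemma mv_cheb: "mv V (cheb V B) v = (\<lambda>x. 4 * mv V B (mv V B (mv V B v)) x - 3 * mv V B v x)"
proof -
  have "mv V (cheb V B) v = (\<lambda>x. 4 * mv V (mm V B (mm V B B)) v x - 3 * mv V B v x)"
    by (simp add: mv_def cheb_def sum_subtractf sum_distrib_left left_diff_distrib mult.assoc)
  then show ?thesis by (simp add: mv_mm)
qed

lemma ip_self_adjoint:
  assumes "\<And>x y. B x y = B y x"
  shows "ip V (mv V B u) v = ip V u (mv V B v)"
proof -
  have "ip V (mv V B u) v = (\<Sum>x\<in>V. \<Sum>y\<in>V. B y x * (u y * v x))"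
    using assms by (simp add: ip_def mv_def sum_distrib_right mult.assoc)
  also have "\<dots> = ip V u (mv V B v)" by (subst sum.swap) (simp add: ip_mv)
  finally show ?thesis .
qed

lemma ip_linear:
  "ip V u (\<lambda>x. a * v x - b * w x) = a * ip V u v - b * ip V u w"
  "ip V (\<lambda>x. a * v x - b * w x) u = a * ip V v u - b * ip V w u"
  by (simp_all add: ip_def sum_subtractf sum_distrib_left left_diff_distrib right_diff_distrib mult_ac)

lemma mv_linear: "mv V B (\<lambda>x. a * v x - b * w x) = (\<lambda>x. a * mv V B v x - b * mv V B w x)"
  by (simp add: mv_def sum_subtractf sum_distrib_left right_diff_distrib mult_ac)

text \<open>The two inequalities are \<open>0 \<le> \<langle>w, (1 + B) w\<rangle>\<close> and \<open>0 \<le> \<langle>w, w\<rangle>\<close>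
  for \<open>w = (a B - b) v\<close>.\<close>

lemma weighting_moments:
  assumes "weighting V G B"
  defines "s1 \<equiv> \<lambda>v. ip V v (mv V B v)"
    and "s2 \<equiv> \<lambda>v. ip V v (mv V B (mv V B v))"
    and "s3 \<equiv> \<lambda>v. ip V v (mv V B (mv V B (mv V B v)))"
  shows "0 \<le> a\<^sup>2 * s3 v + (a\<^sup>2 - 2 * a * b) * s2 v + (b\<^sup>2 - 2 * a * b) * s1 v + b\<^sup>2 * ip V v v"
    and "0 \<le> a\<^sup>2 * s2 v - 2 * a * b * s1 v + b\<^sup>2 * ip V v v"
proof -
  define w where "w = (\<lambda>x. a * mv V B v x - b * v x)"
  have sa: "ip V (mv V B u) v = ip V u (mv V B v)" for u v
    using assms(1) by (intro ip_self_adjoint) (simp add: weighting_def)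
  have comm: "ip V u v = ip V v u" for u v by (simp add: ip_def mult.commute)
  have ww: "ip V w w = a\<^sup>2 * s2 v - 2 * a * b * s1 v + b\<^sup>2 * ip V v v"
    unfolding w_def ip_linear s1_def s2_def
    by (simp add: sa algebra_simps power2_eq_square)
  have "ip V w (mv V B w) = a\<^sup>2 * s3 v - 2 * a * b * s2 v + b\<^sup>2 * s1 v"
    unfolding w_def ip_linear mv_linear s1_def s2_def s3_def
    by (simp add: sa algebra_simps power2_eq_square)
  moreover have "0 \<le> ip V w w + ip V w (mv V B w)"
    using assms(1) by (simp add: weighting_def)
  ultimately show "0 \<le> a\<^sup>2 * s3 v + (a\<^sup>2 - 2 * a * b) * s2 v + (b\<^sup>2 - 2 * a * b) * s1 v + b\<^sup>2 * ip V v v"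
    using ww by (simp add: algebra_simps)
  have "0 \<le> ip V w w" by (simp add: ip_def sum_nonneg)
  then show "0 \<le> a\<^sup>2 * s2 v - 2 * a * b * s1 v + b\<^sup>2 * ip V v v" by (simp add: ww)
qed

text \<open>A nonzero entry of the cube concatenates three odd walks, so parity is kept and the
  length bound triples.\<close>

lemma weighting_cheb:
  assumes w: "weighting V (odd_walks G k) B"
  shows "weighting V (odd_walks G (3 * k)) (cheb V B)"
  unfolding weighting_def
proof (intro conjI allI impI)
  have sym: "B x y = B y x" for x y using w by (simp add: weighting_def)
  show "cheb V B x y = cheb V B y x" for x y
  proof -
    have "mm V B (mm V B B) x y = (\<Sum>z\<in>V. \<Sum>z'\<in>V. B y z' * (B z' z * B z x))"
      unfolding mm_def sum_distrib_left using sym by (intro sum.cong refl) (simp add: mult_ac)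
    also have "\<dots> = mm V B (mm V B B) y x"
      unfolding mm_def sum_distrib_left by (rule sum.swap)
    finally show ?thesis using sym[of x y] by (simp add: cheb_def)
  qed
  \<comment> \<open>\<open>1 + T3 x = (1 + x) (2 x - 1)\<^sup>2\<close>\<close>
  show "0 \<le> ip V v v + ip V v (mv V (cheb V B) v)" for v
    using weighting_moments(1)[OF w, of 2 v 1] by (simp add: mv_cheb ip_linear)
  show "(x, y) \<in> odd_walks G (3 * k)" if nz: "cheb V B x y \<noteq> 0" for x y
  proof (cases "B x y = 0")
    case True
    then have "mm V B (mm V B B) x y \<noteq> 0" using nz by (simp add: cheb_def)
    then obtain z z' where "B x z \<noteq> 0" "B z z' \<noteq> 0" "B z' y \<noteq> 0"
      unfolding mm_def by (metis (mono_tags, lifting) mult_eq_0_iff sum.neutral)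
    then have "(x, z) \<in> odd_walks G k" "(z, z') \<in> odd_walks G k" "(z', y) \<in> odd_walks G k"
      using w by (auto simp: weighting_def)
    then obtain l m n where l: "l \<le> k" "odd l" "(x, z) \<in> G ^^ l"
      and m: "m \<le> k" "odd m" "(z, z') \<in> G ^^ m" and n: "n \<le> k" "odd n" "(z', y) \<in> G ^^ n"
      by (auto simp: odd_walks_def)
    have "(x, y) \<in> G ^^ (l + m + n)"
      using l(3) m(3) n(3) unfolding relpow_add by blast
    then show ?thesis unfolding odd_walks_def using l m n
      by (intro CollectI case_prodI exI[of _ "l + m + n"]) auto
  next
    case False
    then have "(x, y) \<in> odd_walks G k" using w by (auto simp: weighting_def)
    then obtain n where "n \<le> k" "odd n" "(x, y) \<in> G ^^ n" by (auto simp: odd_walks_def)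
    then show ?thesis unfolding odd_walks_def
      by (intro CollectI case_prodI exI[of _ n]) auto
  qed
qed

lemma weighting_cheb_iter:
  assumes "weighting V G B"
  shows "weighting V (odd_walks G (3 ^ j)) ((cheb V ^^ j) B)"
proof (induction j)
  case 0
  have "G \<subseteq> odd_walks G 1" by (auto simp: odd_walks_def)
  then show ?case using assms by (auto simp: weighting_def)
next
  case (Suc j)
  then show ?case using weighting_cheb by fastforce
qed

section \<open>Growth of \<open>T3\<close> and of Rayleigh quotients\<close>

lemma T3_mono:
  assumes "1 \<le> a" "a \<le> b"
  shows "T3 a \<le> T3 b"
proof -
  have "T3 b - T3 a = (b - a) * (4 * (a\<^sup>2 + a * b + b\<^sup>2) - 3)"
    by (simp add: T3_def power2_eq_square power3_eq_cube algebra_simps)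
  moreover have "1 * 1 \<le> a * b" using assms by (intro mult_mono) auto
  ultimately show ?thesis using assms by (smt (verit) mult_nonneg_nonneg zero_le_power2)
qed

lemma T3_ge_one:
  assumes "1 \<le> a" shows "1 \<le> T3 a"
  using T3_mono[of 1 a] assms by (simp add: T3_def)

lemma T3_iter_ge_one: "1 \<le> a \<Longrightarrow> 1 \<le> (T3 ^^ j) a"
  by (induction j) (auto intro: T3_ge_one)

text \<open>Jensen's inequality for \<open>T3\<close> on the spectral measure of \<open>B\<close> at \<open>u\<close>: the tangent at \<open>b\<close>
  lies below \<open>T3\<close> on \<open>[-1, \<infinity>)\<close>, as \<open>T3 x - T3 b - T3' b (x - b) = 4 (x - b)\<^sup>2 (x + 2 b)\<close>.\<close>

lemma rayleigh_cheb:
  assumes w: "weighting V G B" and u: "ip V u u = 1" and a: "1 \<le> a" "a \<le> ip V u (mv V B u)"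
  shows "T3 a \<le> ip V u (mv V (cheb V B) u)"
proof -
  define b where "b = ip V u (mv V B u)"
  define m2 where "m2 = ip V u (mv V B (mv V B u))"
  define m3 where "m3 = ip V u (mv V B (mv V B (mv V B u)))"
  have 1: "0 \<le> m3 + (1 - 2 * b) * m2 + (b\<^sup>2 - 2 * b) * b + b\<^sup>2"
    using weighting_moments(1)[OF w, of 1 u b] u by (simp add: b_def m2_def m3_def)
  have 2: "0 \<le> m2 - b\<^sup>2"
    using weighting_moments(2)[OF w, of 1 u b] u by (simp add: b_def m2_def power2_eq_square)
  \<comment> \<open>Added to the first inequality, this cancels \<open>m2\<close> and leaves
    \<open>b ^ 3 \<le> m3\<close>.\<close>
  have "0 \<le> (2 * b - 1) * (m2 - b\<^sup>2)" using a 2 by (intro mult_nonneg_nonneg) (auto simp: b_def)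
  with 1 have "b ^ 3 \<le> m3" by (simp add: algebra_simps power2_eq_square power3_eq_cube)
  then have "T3 b \<le> ip V u (mv V (cheb V B) u)"
    by (simp add: mv_cheb ip_linear T3_def b_def m3_def)
  then show ?thesis using T3_mono[of a b] a by (simp add: b_def)
qed

lemma rayleigh_cheb_iter:
  assumes w: "weighting V G B" and u: "ip V u u = 1" and a: "1 \<le> a" "a \<le> ip V u (mv V B u)"
  shows "(T3 ^^ j) a \<le> ip V u (mv V ((cheb V ^^ j) B) u)"
proof (induction j)
  case 0
  then show ?case using a by simp
next
  case (Suc j)
  then show ?case
    using rayleigh_cheb[OF weighting_cheb_iter[OF w] u T3_iter_ge_one[OF a(1)]] by simp
qed

text \<open>\<open>I + B\<close> is positive semidefinite with unit diagonal, so its entries are at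
  most 1 in absolute value, and AM-GM bounds the form. This takes the role of comparing the top
  eigenvalue with the trace.\<close>

lemma loopless_weighting_bound:
  assumes fin: "finite V" and w: "weighting V H B" and loop: "\<And>x. x \<in> V \<Longrightarrow> (x, x) \<notin> H"
  shows "ip V u u + ip V u (mv V B u) \<le> real (card V) * ip V u u"
proof -
  define P where "P x y = (if x = y then 1 else 0) + B x y" for x y
  have form: "ip V v v + ip V v (mv V B v) = (\<Sum>x\<in>V. \<Sum>y\<in>V. P x y * (v x * v y))" for v
  proof -
    have "P x y * (v x * v y) = (if x = y then v x * v y else 0) + B x y * (v x * v y)" for x y
      by (simp add: P_def algebra_simps)
    then show ?thesis using fin by (simp add: ip_mv sum.distrib) (simp add: ip_def)
  qed
  have diag: "P x x = 1" if "x \<in> V" for x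
    using w loop[OF that] by (auto simp: P_def weighting_def)
  have P_sym: "P x y = P y x" for x y using w by (auto simp: P_def weighting_def)
  have entry: "\<bar>P x y\<bar> \<le> 1" if xy: "x \<in> V" "y \<in> V" for x y
  proof (cases "x = y")
    case False
    have "0 \<le> P x x * 1\<^sup>2 + 2 * P x y * 1 * d + P y y * d\<^sup>2" for d
    proof -
      have "0 \<le> (\<Sum>a\<in>V. \<Sum>b\<in>V. P a b * ((if a = x then 1 else if a = y then d else 0)
          * (if b = x then 1 else if b = y then d else 0)))"
        unfolding form[of "\<lambda>z. if z = x then 1 else if z = y then d else 0", symmetric]
        using w by (simp add: weighting_def)
      then show ?thesis unfolding quadratic_form_pair[OF fin xy False P_sym refl] .
    qed
    \<comment> \<open>The two choices of \<open>d\<close> give \<open>0 \<le> 2 + 2 * P x y\<close>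
      and \<open>0 \<le> 2 - 2 * P x y\<close>.\<close>
    from this[of 1] this[of "-1"] show ?thesis using diag xy by simp
  qed (use diag xy in simp)
  have "P x y * (u x * u y) \<le> (u x * u x + u y * u y) / 2" if "x \<in> V" "y \<in> V" for x y
  proof -
    have "P x y * (u x * u y) \<le> \<bar>P x y\<bar> * \<bar>u x * u y\<bar>" by (metis abs_ge_self abs_mult)
    also have "\<dots> \<le> 1 * \<bar>u x * u y\<bar>" using entry[OF that] by (intro mult_right_mono) auto
    also have "\<dots> \<le> (u x * u x + u y * u y) / 2"
      using sum_squares_bound[of "\<bar>u x\<bar>" "\<bar>u y\<bar>"] by (simp add: abs_mult power2_eq_square)
    finally show ?thesis .
  qed
  then have "(\<Sum>x\<in>V. \<Sum>y\<in>V. P x y * (u x * u y)) \<le> (\<Sum>x\<in>V. \<Sum>y\<in>V. (u x * u x + u y * u y) / 2)"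
    by (intro sum_mono)
  also have "\<dots> = real (card V) * ip V u u"
    by (simp add: ip_def sum.distrib add_divide_distrib flip: sum_divide_distrib sum_distrib_left)
  finally show ?thesis by (simp add: form)
qed

text \<open>If the Rayleigh quotient exceeded \<open>a\<close>, the normalised \<open>u\<close>
  would give the iterated matrix a quotient of at least \<open>(T3 ^^ j) a\<close>, while the
  absence of short odd closed walks caps it at \<open>card V - 1\<close>.\<close>

lemma rayleigh_bound:
  assumes fin: "finite V" and w: "weighting V G B"
    and loop: "\<And>x. x \<in> V \<Longrightarrow> (x, x) \<notin> odd_walks G (3 ^ j)"
    and a: "1 \<le> a" "real (card V) < 1 + (T3 ^^ j) a"
  shows "ip V u (mv V B u) \<le> a * ip V u u"
proof (rule ccontr)
  assume less: "\<not> ?thesis"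
  define s where "s = sqrt (ip V u u)"
  have nn: "0 \<le> ip V u u" by (simp add: ip_def sum_nonneg)
  have "ip V u u \<noteq> 0"
  proof
    assume 0: "ip V u u = 0"
    then have "\<And>x. x \<in> V \<Longrightarrow> u x = 0" using fin by (simp add: ip_def sum_nonneg_eq_0_iff)
    then have "ip V u (mv V B u) = 0" by (simp add: ip_def)
    with 0 less show False by simp
  qed
  then have s: "s > 0" "s * s = ip V u u" using nn by (simp_all add: s_def)
  \<comment> \<open>The term \<open>0 * u x\<close> brings \<open>v\<close> into the shape of
    \<open>ip_linear\<close> and \<open>mv_linear\<close>.\<close>
  define v where "v = (\<lambda>x. (1 / s) * u x - 0 * u x)"
  have vv: "ip V v v = 1" unfolding v_def ip_linear using s by (simp add: s(2)[symmetric])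
  have "ip V v (mv V B v) = ip V u (mv V B u) / (s * s)"
    unfolding v_def ip_linear mv_linear by simp
  moreover have "0 < ip V u u" using mult_pos_pos[OF s(1) s(1)] s(2) by simp
  ultimately have "a \<le> ip V v (mv V B v)" using less by (simp add: pos_le_divide_eq s(2))
  from rayleigh_cheb_iter[OF w vv a(1) this, of j]
    loopless_weighting_bound[OF fin weighting_cheb_iter[OF w, of j] loop, of v]
  show False using a(2) vv by simp
qed

subsection \<open>Odd closed walks and odd cycles\<close>

text \<open>The start is not repeated in \<open>vs\<close>, so \<open>length vs\<close> counts the
  edges; appending \<open>hd vs\<close> supplies the closing one.\<close>

definition closed_walk :: "('a \<times> 'a) set \<Rightarrow> 'a list \<Rightarrow> bool" where
  "closed_walk G vs \<longleftrightarrow> vs \<noteq> [] \<and> successively (\<lambda>x y. (x, y) \<in> G) (vs @ [hd vs])"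

lemma closed_walk_of_relpow:
  assumes "(x, x) \<in> G ^^ n" "n > 0"
  obtains vs where "closed_walk G vs" "length vs = n"
proof -
  obtain f where f: "f 0 = x" "f n = x" "\<And>i. i < n \<Longrightarrow> (f i, f (Suc i)) \<in> G"
    using assms(1) unfolding relpow_fun_conv by blast
  have "map f [0..<n] @ [hd (map f [0..<n])] = map f [0..<Suc n]"
    using assms(2) f by (simp add: hd_map)
  moreover have "successively (\<lambda>x y. (x, y) \<in> G) (map f [0..<Suc n])"
    unfolding successively_conv_nth using f(3) by (auto simp del: upt_Suc)
  ultimately have "closed_walk G (map f [0..<n])"
    using assms(2) by (simp add: closed_walk_def)
  then show ?thesis using that by auto
qed

text \<open>At a repeated vertex the walk splits into two shorter closed walks whose lengths add up
  to the original one, so one of them is odd.\<close>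

lemma odd_closed_walk_distinct:
  assumes "closed_walk G vs" "odd (length vs)"
  shows "\<exists>us. closed_walk G us \<and> odd (length us) \<and> length us \<le> length vs \<and> distinct us"
  using assms
proof (induction "length vs" arbitrary: vs rule: less_induct)
  case less
  show ?case
  proof (cases "distinct vs")
    case False
    then obtain xs y ys zs where vs: "vs = xs @ [y] @ ys @ [y] @ zs"
      using not_distinct_decomp by blast
    have 1: "closed_walk G (y # ys)"
    proof -
      have "successively (\<lambda>x y. (x, y) \<in> G) (xs @ (y # ys @ [y]) @ zs @ [hd vs])"
        using less.prems(1) by (simp add: closed_walk_def vs)
      then show ?thesis unfolding successively_append_iff by (simp add: closed_walk_def)
    qed
    have 2: "closed_walk G (xs @ y # zs)"
    proof -
      have "successively (\<lambda>x y. (x, y) \<in> G) (xs @ (y # ys) @ (y # zs) @ [hd vs])"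
        using less.prems(1) by (simp add: closed_walk_def vs)
      then have "successively (\<lambda>x y. (x, y) \<in> G) (xs @ (y # zs) @ [hd vs])"
        unfolding successively_append_iff by auto
      moreover have "hd (xs @ y # zs) = hd vs" by (cases xs) (auto simp: vs)
      ultimately show ?thesis by (simp add: closed_walk_def)
    qed
    have "odd (length (y # ys)) \<or> odd (length (xs @ y # zs))"
      using less.prems(2) by (auto simp: vs)
    then show ?thesis
    proof
      assume "odd (length (y # ys))"
      then obtain us where "closed_walk G us" "odd (length us)" "length us \<le> length (y # ys)" "distinct us"
        using less.hyps[OF _ 1] by (auto simp: vs)
      then show ?thesis by (intro exI[of _ us]) (auto simp: vs)
    next
      assume "odd (length (xs @ y # zs))"
      then obtain us where "closed_walk G us" "odd (length us)" "length us \<le> length (xs @ y # zs)" "distinct us"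
        using less.hyps[OF _ 2] by (auto simp: vs)
      then show ?thesis by (intro exI[of _ us]) (auto simp: vs)
    qed
  qed (use less.prems in auto)
qed

section \<open>Odd cycles in the colour graphs\<close>

definition colour_graph :: "nat \<Rightarrow> (nat set \<Rightarrow> nat) \<Rightarrow> nat \<Rightarrow> (nat \<times> nat) set" where
  "colour_graph N c i = {(x, y). x < N \<and> y < N \<and> x \<noteq> y \<and> c {x, y} = i}"

lemma sym_colour_graph: "sym (colour_graph N c i)"
  by (auto simp: sym_def colour_graph_def insert_commute)

lemma odd_cycle_of_odd_walk:
  assumes "(x, x) \<in> odd_walks (colour_graph N c i) k"
  shows "\<exists>vs. is_cycle (complete_graph_edges N) vs \<and> monochromatic c vs \<and>
    odd (cycle_length vs) \<and> cycle_length vs \<le> k"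
proof -
  let ?G = "colour_graph N c i"
  obtain n where n: "n \<le> k" "odd n" "(x, x) \<in> ?G ^^ n"
    using assms by (auto simp: odd_walks_def)
  then have "n > 0" by (intro Nat.gr0I) auto
  then obtain ws where "closed_walk ?G ws" "length ws = n"
    using closed_walk_of_relpow[OF n(3)] by blast
  then obtain vs where cw: "closed_walk ?G vs" and odd: "odd (length vs)"
    and le: "length vs \<le> k" and dist: "distinct vs"
    using odd_closed_walk_distinct[of ?G ws] n by auto
  have "vs \<noteq> []" using odd by auto
  have edge: "(vs ! j, vs ! (Suc j mod length vs)) \<in> ?G" if j: "j < length vs" for j
  proof -
    have "((vs @ [hd vs]) ! j, (vs @ [hd vs]) ! Suc j) \<in> ?G"
      using cw j unfolding closed_walk_def successively_conv_nth by simp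
    then show ?thesis
      using j hd_conv_nth[OF \<open>vs \<noteq> []\<close>]
      by (cases "Suc j = length vs") (auto simp: nth_append)
  qed
  \<comment> \<open>A closed walk of length 1 would be a loop, and colour graphs have none.\<close>
  have "length vs \<noteq> 1" using edge[of 0] \<open>vs \<noteq> []\<close> by (auto simp: colour_graph_def)
  then have "length vs \<ge> 3" using odd by presburger
  moreover have "cycle_edges vs \<subseteq> complete_graph_edges N"
    using edge by (auto simp: cycle_edges_def complete_graph_edges_def colour_graph_def)
  ultimately have cyc: "is_cycle (complete_graph_edges N) vs"
    using dist by (simp add: is_cycle_def)
  have "monochromatic c vs" unfolding monochromatic_def cycle_edges_def
    using edge by (auto simp: colour_graph_def)
  then show ?thesis
    using cyc odd le cycle_length_eq_length[OF cyc] by auto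
qed

text \<open>Without a short odd cycle, an infeasible colour would have a dual weighting with
  \<open>t \<le> (1 + a) * ip V u u \<le> 1 + a\<close>, against \<open>1 + a < t\<close>. So every
  colour is feasible, and the Hadamard product gives \<open>N \<le> t ^ q\<close>.\<close>

lemma short_odd_cycle:
  assumes col: "edge_colouring q N c" and "N > 0"
    and a: "1 \<le> a" "real N < 1 + (T3 ^^ j) a"
    and t: "1 + a < t" "t ^ q < real N"
  shows "\<exists>vs. is_cycle (complete_graph_edges N) vs \<and> monochromatic c vs \<and>
    odd (cycle_length vs) \<and> cycle_length vs \<le> 3 ^ j"
proof (rule ccontr)
  assume none: "\<not> ?thesis"
  let ?V = "{..<N}" and ?G = "colour_graph N c"
  define feas where "feas i P \<longleftrightarrow> gram P \<and> (\<forall>x\<in>?V. 1 + P x x \<le> t) \<and>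
      (\<forall>x\<in>?V. \<forall>y\<in>?V. x \<noteq> y \<longrightarrow> (x, y) \<in> ?G i \<longrightarrow> 1 + P x y = 0)" for i P
  have "\<exists>P. feas i P" for i
  proof (rule ccontr)
    assume no_P: "\<not> ?thesis"
    obtain B u where w: "weighting ?V (?G i) B" and u: "ip ?V u u \<le> 1"
      and t_le: "t \<le> ip ?V u u + ip ?V u (mv ?V B u)"
      using dual_weighting[OF finite_lessThan _ sym_colour_graph no_P[unfolded feas_def]] \<open>N > 0\<close> by auto
    have "(x, x) \<notin> odd_walks (?G i) (3 ^ j)" for x
      using none odd_cycle_of_odd_walk[of x N c i] by blast
    then have "ip ?V u (mv ?V B u) \<le> a * ip ?V u u"
      using a(2) by (intro rayleigh_bound[OF finite_lessThan w _ a(1), of j]) auto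
    then have "t \<le> (1 + a) * ip ?V u u" using t_le by (simp add: algebra_simps)
    also have "\<dots> \<le> (1 + a) * 1" using u a(1) by (intro mult_left_mono) auto
    finally show False using t(1) by simp
  qed
  then obtain P where "\<And>i. feas i (P i)" by metis
  then have P: "\<And>i. gram (P i)" "\<And>i x. x \<in> ?V \<Longrightarrow> 1 + P i x x \<le> t"
    "\<And>i x y. x \<in> ?V \<Longrightarrow> y \<in> ?V \<Longrightarrow> x \<noteq> y \<Longrightarrow> (x, y) \<in> ?G i \<Longrightarrow> 1 + P i x y = 0"
    unfolding feas_def by blast+
  have "\<exists>i<q. 1 + P i x y = 0" if "x \<in> ?V" "y \<in> ?V" "x \<noteq> y" for x y
  proof -
    have "{x, y} \<in> complete_graph_edges N" using that by (auto simp: complete_graph_edges_def)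
    then have "c {x, y} < q" using col by (auto simp: edge_colouring_def)
    moreover have "(x, y) \<in> ?G (c {x, y})" using that by (auto simp: colour_graph_def)
    ultimately show ?thesis using P(3)[OF that] by blast
  qed
  then have "real (card ?V) \<le> t ^ q"
    using P(1,2) \<open>N > 0\<close> by (intro card_le_power[of ?V q P]) auto
  then show False using t(2) by simp
qed

subsection \<open>Choice of parameters\<close>

text \<open>\<open>T3\<close> fixes 1, has slope 9 there and lies above that tangent on
  \<open>[1, \<infinity>)\<close>, so the excess over 1 grows at least ninefold per step.\<close>

lemma T3_iter_lower:
  assumes "1 \<le> a"
  shows "1 + 9 ^ j * (a - 1) \<le> (T3 ^^ j) a"
proof (induction j)
  case (Suc j)
  let ?x = "(T3 ^^ j) a"
  have x: "1 \<le> ?x" using T3_iter_ge_one[OF assms] .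
  have "T3 ?x - 1 - 9 * (?x - 1) = (?x - 1)\<^sup>2 * (4 * ?x + 8)"
    by (simp add: T3_def power2_eq_square power3_eq_cube algebra_simps)
  also have "\<dots> \<ge> 0" using x by (intro mult_nonneg_nonneg) auto
  finally have "1 + 9 * (?x - 1) \<le> T3 ?x" by simp
  then show ?case using Suc by simp
qed (use assms in simp)

text \<open>\<open>T3 x \<ge> x ^ 3\<close> for \<open>x \<ge> 1\<close>, so the exponent triples at
  each step.\<close>

lemma T3_iter_ge_power:
  assumes "2 \<le> a"
  shows "2 ^ (3 ^ j) \<le> (T3 ^^ j) a"
proof (induction j)
  case (Suc j)
  let ?x = "(T3 ^^ j) a"
  have x: "1 \<le> ?x" using T3_iter_ge_one assms by simp
  have "(2 ^ (3 ^ j)) ^ 3 \<le> ?x ^ 3" using Suc by (intro power_mono) auto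
  also have "\<dots> \<le> T3 ?x"
  proof -
    have "T3 ?x - ?x ^ 3 = 3 * ?x * (?x - 1) * (?x + 1)"
      by (simp add: T3_def power3_eq_cube algebra_simps)
    also have "\<dots> \<ge> 0" using x by (intro mult_nonneg_nonneg) auto
    finally show ?thesis by simp
  qed
  finally show ?case by (simp add: power_mult[symmetric] mult.commute)
qed (use assms in simp)

lemma power_bracket:
  fixes b y :: real
  assumes "b > 1" "y \<ge> 1"
  obtains m :: nat where "y \<le> b ^ m" "b ^ m \<le> b * y"
proof -
  \<comment> \<open>By minimality the previous power is below \<open>y\<close>, so the overshoot is
    at most a factor \<open>b\<close>.\<close>
  define m where "m = (LEAST m. y \<le> b ^ m)"
  obtain m0 where "y < b ^ m0" using real_arch_pow[OF assms(1)] by blast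
  then have ge: "y \<le> b ^ m" unfolding m_def by (intro LeastI[of "\<lambda>m. y \<le> b ^ m"] less_imp_le)
  have "b ^ m \<le> b * y"
  proof (cases m)
    case 0
    have "1 * 1 \<le> b * y" using assms by (intro mult_mono) auto
    then show ?thesis using 0 by simp
  next
    case (Suc k)
    then have "\<not> y \<le> b ^ k" using not_less_Least[of k "\<lambda>m. y \<le> b ^ m"] by (simp add: m_def)
    then show ?thesis using assms(1) Suc by simp
  qed
  then show ?thesis using ge that by blast
qed

lemma power_perturbed_less:
  fixes q :: nat
  assumes "q > 0"
  shows "(2 + 1 / (q * 2 ^ q)) ^ q < 2 ^ q + (1::real)"
proof -
  \<comment> \<open>Then the base is \<open>2 * (1 + x / q)\<close>, and
    \<open>2 ^ q * (2 * x) = 1\<close> is exactly the room available.\<close>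
  define x :: real where "x = 1 / (2 * 2 ^ q)"
  have "1 \<le> (2::real) ^ q" by simp
  then have "1 < 2 * (2::real) ^ q" by linarith
  then have x: "0 < x" "x < 1" by (auto simp: x_def)
  have "(2 + 1 / (q * 2 ^ q)) ^ q = 2 ^ q * (1 + x / q) ^ q"
    using assms by (simp add: x_def field_simps flip: power_mult_distrib)
  also have "(1 + x / q) ^ q \<le> exp x"
    using exp_ge_one_plus_x_over_n_power_n[of q x] assms x by simp
  also have "exp x \<le> 1 + x + x\<^sup>2" using exp_bound[of x] x by simp
  also have "\<dots> < 1 + 2 * x" using x by (simp add: power2_eq_square)
  also have "2 ^ q * (1 + 2 * x) = 2 ^ q + 1" by (simp add: x_def field_simps)
  finally show ?thesis by simp
qed

lemma short_odd_cycle_param: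
  assumes q: "q > 0" and col: "edge_colouring q (2 ^ q + 1) c"
  shows "\<exists>vs. is_cycle (complete_graph_edges (2 ^ q + 1)) vs \<and> monochromatic c vs \<and>
    odd (cycle_length vs) \<and> real (cycle_length vs) \<le> 9 * real (q + 1) * sqrt (3 * q * 2 ^ q)"
proof -
  \<comment> \<open>With \<open>a = 1 + \<delta>\<close>, the sum \<open>1 + a\<close> stays
    strictly below \<open>t = 2 + 1 / (q * 2 ^ q)\<close>.\<close>
  define \<delta> :: real where "\<delta> = 1 / (3 * q * 2 ^ q)"
  have "1 * 1 \<le> 3 * real q * 2 ^ q" using q by (intro mult_mono) auto
  then have y: "1 \<le> sqrt (3 * real q * 2 ^ q)" by simp
  \<comment> \<open>First phase: \<open>m\<close> iterations lift \<open>1 + \<delta>\<close> to at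
    least 2, as \<open>9 ^ m\<close>, the square of \<open>3 ^ m\<close>, reaches
    \<open>1 / \<delta>\<close>.\<close>
  obtain m where m: "sqrt (3 * real q * 2 ^ q) \<le> 3 ^ m" "3 ^ m \<le> 3 * sqrt (3 * real q * 2 ^ q)"
    using power_bracket[OF _ y, of 3] by auto
  \<comment> \<open>Second phase: \<open>l\<close> more iterations lift 2 to at least
    \<open>2 ^ (q + 1)\<close>. Rounding to a power of 3 costs a factor 3 in each phase, hence the 9
    in the bound.\<close>
  obtain l where l: "real (q + 1) \<le> 3 ^ l" "3 ^ l \<le> 3 * real (q + 1)"
    using power_bracket[of 3 "real (q + 1)"] by auto
  have "3 * real q * 2 ^ q \<le> (3 ^ m)\<^sup>2"
    by (rule sqrt_le_D[OF m(1)])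
  also have "(3 ^ m)\<^sup>2 = (9 :: real) ^ m" by (simp add: power2_eq_square flip: power_mult_distrib)
  finally have "1 \<le> 9 ^ m * \<delta>" using q by (simp add: \<delta>_def field_simps)
  then have "2 \<le> (T3 ^^ m) (1 + \<delta>)"
    using T3_iter_lower[of "1 + \<delta>" m] by (simp add: \<delta>_def)
  then have "2 ^ (3 ^ l) \<le> (T3 ^^ (l + m)) (1 + \<delta>)"
    using T3_iter_ge_power by (simp add: funpow_add)
  moreover have "(2::real) ^ (q + 1) \<le> 2 ^ (3 ^ l)"
  proof (rule power_increasing)
    have "real (q + 1) \<le> real (3 ^ l)" using l(1) by simp
    then show "q + 1 \<le> 3 ^ l" by (simp only: of_nat_le_iff)
  qed simp
  moreover have "1 < (2::real) ^ q" using q by simp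
  ultimately have big: "real (2 ^ q + 1) < 1 + (T3 ^^ (l + m)) (1 + \<delta>)" by simp
  have "1 + (1 + \<delta>) < 2 + 1 / (q * 2 ^ q)" using q by (simp add: \<delta>_def field_simps)
  moreover have "(2 + 1 / (q * 2 ^ q)) ^ q < real (2 ^ q + 1)" using power_perturbed_less[OF q] by simp
  moreover have "1 \<le> 1 + \<delta>" by (simp add: \<delta>_def)
  ultimately obtain vs where vs: "is_cycle (complete_graph_edges (2 ^ q + 1)) vs" "monochromatic c vs"
    "odd (cycle_length vs)" "cycle_length vs \<le> 3 ^ (l + m)"
    using short_odd_cycle[OF col _ _ big] by fastforce
  have "real (cycle_length vs) \<le> real (3 ^ (l + m))"
    using vs(4) by (simp only: of_nat_le_iff)
  also have "\<dots> = 3 ^ l * 3 ^ m" by (simp add: power_add)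
  also have "\<dots> \<le> (3 * real (q + 1)) * (3 * sqrt (3 * real q * 2 ^ q))"
    using l m by (intro mult_mono) auto
  also have "\<dots> = 9 * real (q + 1) * sqrt (3 * q * 2 ^ q)" by simp
  finally show ?thesis using vs by blast
qed

theorem theorem1p2:
  fixes \<epsilon> :: real
  assumes "\<epsilon> > 0"
  shows "\<exists>q0::real. q0 > 0 \<and>
    (\<forall>q::nat. real q > q0 \<longrightarrow>
      (\<forall>c. edge_colouring q (2 ^ q + 1) c \<longrightarrow>
        (\<exists>vs. is_cycle (complete_graph_edges (2 ^ q + 1)) vs \<and>
              monochromatic c vs \<and>
              odd (cycle_length vs) \<and>
              real (cycle_length vs) \<le> (2 ^ q + 1) / real q powr (1 - \<epsilon>))))"
proof -
  \<comment> \<open>The left side has order \<open>q powr (3/2) * 2 powr (q/2)\<close>,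
    exponentially smaller than the right; the denominator \<open>real q\<close> dominates
    \<open>real q powr (1 - \<epsilon>)\<close> once \<open>q \<ge> 1\<close>.\<close>
  have "eventually (\<lambda>q::nat. 9 * real (q + 1) * sqrt (3 * q * 2 ^ q) \<le> (2 ^ q + 1) / real q) at_top"
    by real_asymp
  then obtain n where n: "\<And>q. q \<ge> n \<Longrightarrow> 9 * real (q + 1) * sqrt (3 * q * 2 ^ q) \<le> (2 ^ q + 1) / real q"
    by (auto simp: eventually_at_top_linorder)
  show ?thesis
  \<comment> \<open>The threshold ensures both \<open>q \<ge> n\<close> and \<open>q > 1\<close>,
    the latter for monotonicity of \<open>powr\<close> in the exponent.\<close>
  proof (intro exI[of _ "real n + 1"] conjI allI impI)
    fix q :: nat and c
    assume q: "real q > real n + 1" and col: "edge_colouring q (2 ^ q + 1) c"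
    have "real q powr (1 - \<epsilon>) \<le> real q powr 1" using q assms by (intro powr_mono) auto
    then have "(2 ^ q + 1) / real q \<le> (2 ^ q + 1) / real q powr (1 - \<epsilon>)"
      using q by (intro divide_left_mono) auto
    then have "9 * real (q + 1) * sqrt (3 * q * 2 ^ q) \<le> (2 ^ q + 1) / real q powr (1 - \<epsilon>)"
      using n[of q] q by linarith
    then show "\<exists>vs. is_cycle (complete_graph_edges (2 ^ q + 1)) vs \<and> monochromatic c vs \<and>
        odd (cycle_length vs) \<and> real (cycle_length vs) \<le> (2 ^ q + 1) / real q powr (1 - \<epsilon>)"
      using short_odd_cycle_param[OF _ col] q by force
  qed simp
qed

end
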